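(* Let $k\ge 1$ be an integer and let $B$ be a real number. If $A=1$, then the equilibrium point $\bar z=0$ of $$z_{n+k}=\frac{z_n}{A+Bz_n},\qquad n\ge 0,$$ is non-hyperbolic.
   Context: For a difference equation $z_{n+k}=\mathcal{A}(z_n,z_{n+1},\dots,z_{n+k-1})$ with equilibrium point $\bar z$, put $p_i=\frac{\partial \mathcal{A}}{\partial z_{n+i}}(\bar z,\dots,\bar z)$ for $i=0,\dots,k-1$. The characteristic equation near $\bar z$ is $\lambda^k-p_{k-1}\lambda^{k-1}-\dots-p_1\lambda-p_0=0$. The equilibrium point $\bar z$ is called non-hyperbolic if the characteristic equation has a (complex) root of absolute value equal to one. *)

theory Defs
  imports Complex_Main
begin

text \<open>
  A difference equation \<open>z (n + k) = F [z n, z (n + 1), \<dots>, z (n + k - 1)]\<close> of order \<open>k\<close> is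
  represented by \<open>k\<close> and its right-hand side \<open>F\<close>, where the \<open>k\<close> arguments of \<open>F\<close> are collected in a
  list of length \<open>k\<close>. Only the values of \<open>F\<close> on lists of length \<open>k\<close> are relevant.
\<close>

definition equilibrium_point :: "nat \<Rightarrow> (real list \<Rightarrow> real) \<Rightarrow> real \<Rightarrow> bool" where
  "equilibrium_point k F zbar \<longleftrightarrow> F (replicate k zbar) = zbar"

text \<open>
  \<open>p\<close> is the partial derivative of \<open>F\<close> with respect to its argument number \<open>i\<close> (counted from \<open>0\<close>),
  that is, with respect to \<open>z (n + i)\<close>, at the point \<open>(zbar, \<dots>, zbar)\<close>.
\<close>

definition has_partial_at_diag ::
    "nat \<Rightarrow> (real list \<Rightarrow> real) \<Rightarrow> real \<Rightarrow> nat \<Rightarrow> real \<Rightarrow> bool" where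
  "has_partial_at_diag k F zbar i p \<longleftrightarrow>
     ((\<lambda>t. F ((replicate k zbar)[i := t])) has_real_derivative p) (at zbar)"

definition characteristic_root :: "nat \<Rightarrow> (nat \<Rightarrow> real) \<Rightarrow> complex \<Rightarrow> bool" where
  "characteristic_root k p l \<longleftrightarrow> l ^ k - (\<Sum>i<k. complex_of_real (p i) * l ^ i) = 0"

text \<open>
  The coefficients \<open>p i\<close> are introduced by an existential quantifier, so that the existence of all
  partial derivatives is part of the notion; for \<open>i < k\<close> they are uniquely determined.
\<close>

definition non_hyperbolic :: "nat \<Rightarrow> (real list \<Rightarrow> real) \<Rightarrow> real \<Rightarrow> bool" where
  "non_hyperbolic k F zbar \<longleftrightarrow>
     equilibrium_point k F zbar \<and>
     (\<exists>p. (\<forall>i<k. has_partial_at_diag k F zbar i (p i)) \<and>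
          (\<exists>l. characteristic_root k p l \<and> cmod l = 1))"

text \<open>
  The right-hand side of \<open>z (n + k) = z n / (A + B * z n)\<close>; the entry \<open>zs ! 0\<close> is \<open>z n\<close>. Where
  \<open>A + B * z n = 0\<close>, the equation is undefined and the value \<open>0\<close> is a convention of division in HOL;
  if \<open>A \<noteq> 0\<close>, this does not occur near \<open>z n = 0\<close>.
\<close>

definition rational_rhs :: "real \<Rightarrow> real \<Rightarrow> real list \<Rightarrow> real" where
  "rational_rhs A B zs = zs ! 0 / (A + B * zs ! 0)"

end

theory Submission
  imports Defs
begin

text \<open>
  With \<open>A = 1\<close> the map \<open>t \<mapsto> t / (1 + B t)\<close> has derivative \<open>1\<close> at its fixed point \<open>0\<close>, and the
  right-hand side does not depend on \<open>z (n + 1), \<dots>, z (n + k - 1)\<close>. Hence the characteristic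
  equation is \<open>\<lambda> ^ k - 1 = 0\<close>: its roots are the \<open>k\<close>-th roots of unity, all of absolute value
  one, and \<open>\<lambda> = 1\<close> is a witness for every \<open>k\<close>.
\<close>

theorem theorem2p5:
  fixes k :: nat and A B :: real
  assumes "k \<ge> 1" and "A = 1"
  shows "non_hyperbolic k (rational_rhs A B) 0"
proof -
  define p :: "nat \<Rightarrow> real" where "p i = (if i = 0 then 1 else 0)" for i
  have "equilibrium_point k (rational_rhs A B) 0"
    using assms by (simp add: equilibrium_point_def rational_rhs_def)
  moreover have "has_partial_at_diag k (rational_rhs A B) 0 i (p i)" if "i < k" for i
  proof (cases "i = 0")
    case True
    have "((\<lambda>t. t / (1 + B * t)) has_real_derivative 1) (at 0)"
      by (auto intro!: derivative_eq_intros)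
    with True that show ?thesis
      using assms by (simp add: has_partial_at_diag_def rational_rhs_def p_def)
  next
    case False
    with that show ?thesis
      by (simp add: has_partial_at_diag_def rational_rhs_def p_def)
  qed
  moreover have "characteristic_root k p 1"
  proof -
    have "(\<Sum>i<k. complex_of_real (p i)) = (\<Sum>i<k. if i = 0 then 1 else 0)"
      by (rule sum.cong) (auto simp: p_def)
    also have "\<dots> = 1"
      using assms by simp
    finally show ?thesis
      by (simp add: characteristic_root_def)
  qed
  ultimately show ?thesis
    unfolding non_hyperbolic_def using norm_one by blast
qed

end
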